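(* Let $n\ge 1$, let $\mathbb{V}$ be an $n$-dimensional vector space over a field $\mathbb{F}$ with basis $\mathcal{B}=\{v_1,\dots,v_n\}$, and let $t=|V_{12\cdots n}|=(|\mathbb{F}|-1)^n$. Let $\mathbb{IG(V)}$ and $\mathbb{UG(V)}$ be the nonzero component graph and the nonzero component union graph of $\mathbb{V}$ with respect to $\mathcal{B}$, let $\mathbb{L}$ be the lattice constructed from $\mathbb{V}$ as described in the context, and let $\mathbb{L}^\partial$ be its dual lattice. Then: (1) $\mathbb{IG(V)}=G^c(\mathbb{L})\vee K_t$; (2) $\mathbb{UG(V)}=G(\mathbb{L}^\partial)\vee K_t$.
   Context: All graphs are simple. For $a=a_1v_1+\dots+a_nv_n\in\mathbb{V}$, the skeleton of $a$ is $S_{\mathcal{B}}(a)=\{v_i\mid a_i\neq 0\}$. The nonzero component graph $\mathbb{IG(V)}$ has vertex set $\mathbb{V}\setminus\{0\}$, with distinct $a,b$ adjacent iff $S_{\mathcal{B}}(a)\cap S_{\mathcal{B}}(b)\neq\emptyset$. The nonzero component union graph $\mathbb{UG(V)}$ has vertex set $\mathbb{V}\setminus\{0\}$, with distinct $a,b$ adjacent iff $S_{\mathcal{B}}(a)\cup S_{\mathcal{B}}(b)=\mathcal{B}$. For $I\subseteq\{1,\dots,n\}$ let $V_I=\{a\in\mathbb{V}\mid a_j\neq 0\Leftrightarrow j\in I\}$; thus $V_\emptyset=\{0\}$, the sets $V_I$ partition $\mathbb{V}$, and $V_{12\cdots n}$ denotes $V_{\{1,\dots,n\}}$. Construction of $\mathbb{L}$: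 start from the Boolean lattice $[\mathbb{V}]=\{V_I\mid I\subseteq\{1,\dots,n\}\}$ ordered by $V_I\le V_J\iff I\subseteq J$. Replace each $V_I$ with $I\ne\emptyset,\{1,\dots,n\}$ by the chain consisting of the elements of $V_I$ in some fixed well-order $\le_I$ having a greatest element, and replace $V_\emptyset$ and $V_{\{1,\dots,n\}}$ by single elements $0$ and $1$ respectively. Explicitly, $\mathbb{L}=\{0,1\}\cup\bigcup_{\emptyset\ne I\subsetneq\{1,\dots,n\}}V_I$, with least element $0$, greatest element $1$, and for $x\in V_I$, $y\in V_J$: $x\le y$ iff either $I\subsetneq J$, or $I=J$ and $x\le_I y$. The dual $\mathbb{L}^\partial$ is $\mathbb{L}$ with the reversed order (so its zero element is $1$). For a poset $P$ with least element $0$, write $\{a,b\}^\ell=\{c\in P\mid c\le a,\ c\le b\}$ and $Z(P)=\{a\in P\mid \exists\, b\in P\setminus\{0\}:\ \{a,b\}^\ell=\{0\}\}$. The zero-divisor graph $G(P)$ has vertex set $Z(P)\setminus\{0\}$ (possibly empty), with distinct $a,b$ adjacent iff $\{a,b\}^\ell=\{0\}$; $G^c(P)$ is the complement of $G(P)$. The join $G\vee H$ of two graphs is formed from disjoint copies of $G$ and $H$ by joining every vertex of $G$ to every vertex of $H$. $K_t$ is the complete graph on $t$ vertices ($t$ may be an infinite cardinal); in the stated equalities $K_t$ is taken to be the complete graph on the vertex set $V_{12\cdots n}$. *)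

theory Defs
  imports Complex_Main "HOL-Algebra.Order"
begin

unbundle cardinal_syntax

section \<open>Simple graphs\<close>

record 'v sgraph =
  verts :: "'v set"
  edges :: "'v set set"

definition graph_on :: "'v set \<Rightarrow> ('v \<Rightarrow> 'v \<Rightarrow> bool) \<Rightarrow> 'v sgraph" where
  "graph_on V adj =
     \<lparr>verts = V, edges = {{a, b} | a b. a \<in> V \<and> b \<in> V \<and> a \<noteq> b \<and> adj a b}\<rparr>"

definition complete_graph :: "'v set \<Rightarrow> 'v sgraph" where
  "complete_graph V = graph_on V (\<lambda>a b. True)"

definition graph_complement :: "'v sgraph \<Rightarrow> 'v sgraph" where
  "graph_complement G = graph_on (verts G) (\<lambda>a b. {a, b} \<notin> edges G)"

text \<open>The sum type supplies the disjoint copies of the two graphs.\<close>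

definition graph_join :: "'v sgraph \<Rightarrow> 'w sgraph \<Rightarrow> ('v + 'w) sgraph" where
  "graph_join G H =
     \<lparr>verts = verts G <+> verts H,
      edges = (`) Inl ` edges G \<union> (`) Inr ` edges H
              \<union> {{Inl a, Inr b} | a b. a \<in> verts G \<and> b \<in> verts H}\<rparr>"

text \<open>Equality of graphs up to the given injective renaming \<open>f\<close> of the vertices.\<close>

definition graph_eq_via :: "('v \<Rightarrow> 'w) \<Rightarrow> 'v sgraph \<Rightarrow> 'w sgraph \<Rightarrow> bool" where
  "graph_eq_via f G H \<longleftrightarrow>
     inj_on f (verts G) \<and> \<lparr>verts = f ` verts G, edges = (`) f ` edges G\<rparr> = H"

section \<open>Zero-divisor graphs of posets\<close>

text \<open>Only meaningful if \<open>P\<close> has a least element.\<close>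

definition poset_zero :: "('p, 'm) gorder_scheme \<Rightarrow> 'p" where
  "poset_zero P = (THE z. least P z (carrier P))"

definition zero_divisors :: "('p, 'm) gorder_scheme \<Rightarrow> 'p set" where
  "zero_divisors P =
     {a \<in> carrier P. \<exists>b \<in> carrier P - {poset_zero P}. Lower P {a, b} = {poset_zero P}}"

definition zero_divisor_graph :: "('p, 'm) gorder_scheme \<Rightarrow> 'p sgraph" where
  "zero_divisor_graph P =
     graph_on (zero_divisors P - {poset_zero P}) (\<lambda>a b. Lower P {a, b} = {poset_zero P})"

section \<open>Graphs and the lattice of a vector space with a basis \<open>v 1, \<dots>, v n\<close>\<close>

text \<open>\<open>coord scale v n a i\<close> is the coefficient \<open>a\<^sub>i\<close> of \<open>a = a\<^sub>1 v\<^sub>1 + \<dots> + a\<^sub>n v\<^sub>n\<close>.\<close>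

definition coord ::
  "('f::field \<Rightarrow> 'v::ab_group_add \<Rightarrow> 'v) \<Rightarrow> (nat \<Rightarrow> 'v) \<Rightarrow> nat \<Rightarrow> 'v \<Rightarrow> nat \<Rightarrow> 'f" where
  "coord scale v n a i = module.representation scale (v ` {1..n}) a (v i)"

definition skeleton ::
  "('f::field \<Rightarrow> 'v::ab_group_add \<Rightarrow> 'v) \<Rightarrow> (nat \<Rightarrow> 'v) \<Rightarrow> nat \<Rightarrow> 'v \<Rightarrow> 'v set" where
  "skeleton scale v n a = {v i | i. i \<in> {1..n} \<and> coord scale v n a i \<noteq> 0}"

definition component_graph ::
  "('f::field \<Rightarrow> 'v::ab_group_add \<Rightarrow> 'v) \<Rightarrow> (nat \<Rightarrow> 'v) \<Rightarrow> nat \<Rightarrow> 'v sgraph" where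
  "component_graph scale v n =
     graph_on (UNIV - {0}) (\<lambda>a b. skeleton scale v n a \<inter> skeleton scale v n b \<noteq> {})"

definition component_union_graph ::
  "('f::field \<Rightarrow> 'v::ab_group_add \<Rightarrow> 'v) \<Rightarrow> (nat \<Rightarrow> 'v) \<Rightarrow> nat \<Rightarrow> 'v sgraph" where
  "component_union_graph scale v n =
     graph_on (UNIV - {0}) (\<lambda>a b. skeleton scale v n a \<union> skeleton scale v n b = v ` {1..n})"

definition vclass ::
  "('f::field \<Rightarrow> 'v::ab_group_add \<Rightarrow> 'v) \<Rightarrow> (nat \<Rightarrow> 'v) \<Rightarrow> nat \<Rightarrow> nat set \<Rightarrow> 'v set" where
  "vclass scale v n I = {a. \<forall>j \<in> {1..n}. coord scale v n a j \<noteq> 0 \<longleftrightarrow> j \<in> I}"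

definition proper_indices :: "nat \<Rightarrow> nat set set" where
  "proper_indices n = {I. I \<noteq> {} \<and> I \<subset> {1..n}}"

text \<open>
  \<open>ord I\<close> is the order chosen on the class of \<open>I\<close>, as a set of pairs \<open>(x, y)\<close> with \<open>x\<close> below \<open>y\<close>.
\<close>

definition admissible_orders ::
  "('f::field \<Rightarrow> 'v::ab_group_add \<Rightarrow> 'v) \<Rightarrow> (nat \<Rightarrow> 'v) \<Rightarrow> nat \<Rightarrow> (nat set \<Rightarrow> 'v rel) \<Rightarrow> bool" where
  "admissible_orders scale v n ord \<longleftrightarrow>
     (\<forall>I \<in> proper_indices n.
        well_order_on (vclass scale v n I) (ord I) \<and>
        (\<exists>m \<in> vclass scale v n I. \<forall>x \<in> vclass scale v n I. (x, m) \<in> ord I))"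

text \<open>\<open>Zero\<close> and \<open>One\<close> are new points replacing the classes of \<open>{}\<close> and \<open>{1..n}\<close>.\<close>

datatype 'v lelem = Zero | One | Vec 'v

definition lle ::
  "('f::field \<Rightarrow> 'v::ab_group_add \<Rightarrow> 'v) \<Rightarrow> (nat \<Rightarrow> 'v) \<Rightarrow> nat \<Rightarrow> (nat set \<Rightarrow> 'v rel)
     \<Rightarrow> 'v lelem \<Rightarrow> 'v lelem \<Rightarrow> bool" where
  "lle scale v n ord p q \<longleftrightarrow>
     p = Zero \<or> q = One \<or>
     (\<exists>x y. p = Vec x \<and> q = Vec y \<and>
        (\<exists>I \<in> proper_indices n. \<exists>J \<in> proper_indices n.
           x \<in> vclass scale v n I \<and> y \<in> vclass scale v n J \<and>
           (I \<subset> J \<or> I = J \<and> (x, y) \<in> ord I)))"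

definition lattice_of ::
  "('f::field \<Rightarrow> 'v::ab_group_add \<Rightarrow> 'v) \<Rightarrow> (nat \<Rightarrow> 'v) \<Rightarrow> nat \<Rightarrow> (nat set \<Rightarrow> 'v rel)
     \<Rightarrow> 'v lelem gorder" where
  "lattice_of scale v n ord =
     \<lparr>carrier = {Zero, One} \<union> Vec ` (\<Union>I \<in> proper_indices n. vclass scale v n I),
      eq = (=),
      le = lle scale v n ord\<rparr>"

text \<open>
  The copy of a nonzero vector in the join of a graph on the lattice with the complete graph
  on \<open>V\<^bsub>12\<dots>n\<^esub>\<close>.
\<close>

definition join_copy ::
  "('f::field \<Rightarrow> 'v::ab_group_add \<Rightarrow> 'v) \<Rightarrow> (nat \<Rightarrow> 'v) \<Rightarrow> nat \<Rightarrow> 'v \<Rightarrow> 'v lelem + 'v" where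
  "join_copy scale v n a = (if a \<in> vclass scale v n {1..n} then Inr a else Inl (Vec a))"

end

theory Submission
  imports Defs
begin

text \<open>
  Let \<open>S a\<close> be the set of indices of the nonzero coordinates of \<open>a\<close>. Classes are nonempty chains, so
  two vectors \<open>x, y\<close> of proper classes have only \<open>0\<close> as a common lower bound in the lattice iff
  \<open>S x \<inter> S y = {}\<close>, and only \<open>1\<close> as a common upper bound iff \<open>S x \<union> S y = {1..n}\<close>. Each such
  vector has a partner in the complementary class, so the nonzero zero-divisors are exactly
  these vectors. The vectors of full support are adjacent to all others in both component graphs.
\<close>

section \<open>Graphs: complements, joins and equality up to renaming\<close>

lemma verts_graph_on [simp]: "verts (graph_on V adj) = V"
  by (simp add: graph_on_def)

lemma verts_complete_graph [simp]: "verts (complete_graph V) = V"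
  by (simp add: complete_graph_def)

lemma edges_graph_on: "edges (graph_on V adj) = {{a, b} | a b. a \<in> V \<and> b \<in> V \<and> a \<noteq> b \<and> adj a b}"
  by (simp add: graph_on_def)

lemma edges_graph_join:
  "edges (graph_join G H) = (`) Inl ` edges G \<union> (`) Inr ` edges H
     \<union> {{Inl a, Inr b} | a b. a \<in> verts G \<and> b \<in> verts H}"
  by (simp add: graph_join_def)

lemma graph_on_cong:
  assumes "\<And>a b. a \<in> V \<Longrightarrow> b \<in> V \<Longrightarrow> a \<noteq> b \<Longrightarrow> adj a b \<longleftrightarrow> adj' a b"
  shows "graph_on V adj = graph_on V adj'"
proof -
  have "{{a, b} | a b. a \<in> V \<and> b \<in> V \<and> a \<noteq> b \<and> adj a b} =
      {{a, b} | a b. a \<in> V \<and> b \<in> V \<and> a \<noteq> b \<and> adj' a b}"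
    using assms by blast
  then show ?thesis by (simp add: graph_on_def)
qed

text \<open>Edges are unordered pairs, so \<open>{a, b}\<close> may be an edge because of
  \<open>adj b a\<close>; symmetry rules out that this happens without
  \<open>adj a b\<close>.\<close>

lemma graph_complement_graph_on:
  assumes "\<And>a b. adj a b \<Longrightarrow> adj b a"
  shows "graph_complement (graph_on V adj) = graph_on V (\<lambda>a b. \<not> adj a b)"
  unfolding graph_complement_def verts_graph_on
proof (rule graph_on_cong)
  fix a b assume "a \<in> V" "b \<in> V" "a \<noteq> b"
  then show "{a, b} \<notin> edges (graph_on V adj) \<longleftrightarrow> \<not> adj a b"
    using assms by (auto simp: edges_graph_on doubleton_eq_iff)
qed

text \<open>Common core of both claims: it is applied with \<open>h = Vec\<close>, with
  \<open>A\<close> the vectors of proper classes and \<open>C\<close> the vectors of full support.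
  What remains is to compare adjacency on \<open>A\<close> and to show that \<open>C\<close> is
  adjacent to everything. The assumption on \<open>C\<close> is stated in both directions because
  \<open>adj\<close> is not assumed symmetric.\<close>

lemma graph_eq_via_join_complete:
  fixes h :: "'v \<Rightarrow> 'w"
  assumes inj: "inj_on h A" and disj: "A \<inter> C = {}"
    and adj: "\<And>x y. x \<in> A \<Longrightarrow> y \<in> A \<Longrightarrow> adj' (h x) (h y) \<longleftrightarrow> adj x y"
    and univ: "\<And>c x. c \<in> C \<Longrightarrow> x \<in> A \<union> C \<Longrightarrow> adj c x \<and> adj x c"
  shows "graph_eq_via (\<lambda>a. if a \<in> C then Inr a else Inl (h a))
           (graph_on (A \<union> C) adj) (graph_join (graph_on (h ` A) adj') (complete_graph C))"
    (is "graph_eq_via _ ?G ?H")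
proof -
  define f where "f = (\<lambda>a. if a \<in> C then Inr a else Inl (h a))"
  have fA: "f x = Inl (h x)" if "x \<in> A" for x using that disj by (auto simp: f_def)
  have fC: "f x = Inr x" if "x \<in> C" for x using that by (simp add: f_def)
  have "inj_on f (A \<union> C)"
    using inj disj by (auto simp: inj_on_def f_def)
  moreover have "f ` (A \<union> C) = verts ?H"
    using fA fC by (force simp: graph_join_def complete_graph_def)
  moreover have "(`) f ` edges ?G = edges ?H"
  proof (intro subset_antisym subsetI)
    fix e assume "e \<in> (`) f ` edges ?G"
    then obtain a b where e: "e = {f a, f b}" and a: "a \<in> A \<union> C" and b: "b \<in> A \<union> C"
      and ab: "a \<noteq> b" "adj a b"
      unfolding edges_graph_on by blast
    consider "a \<in> A" "b \<in> A" | "a \<in> A" "b \<in> C" | "a \<in> C" "b \<in> A" | "a \<in> C" "b \<in> C"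
      using a b by blast
    then show "e \<in> edges ?H"
    proof cases
      case 1
      \<comment> \<open>Injectivity of \<open>h\<close> keeps the endpoints apart, so the edge does
        not collapse to a loop.\<close>
      then have "h a \<noteq> h b" "adj' (h a) (h b)"
        using ab adj inj_onD[OF inj] by blast+
      then have "{h a, h b} \<in> edges (graph_on (h ` A) adj')"
        using 1 unfolding edges_graph_on by blast
      then have "Inl ` {h a, h b} \<in> edges ?H"
        unfolding edges_graph_join by blast
      then show ?thesis using e fA 1 by simp
    next
      case 2
      then have "e = {Inl (h a), Inr b}" using e fA fC by simp
      then show ?thesis
        using 2 unfolding edges_graph_join verts_graph_on verts_complete_graph by blast
    next
      case 3
      then have "e = {Inl (h b), Inr a}" using e fA fC by (simp add: insert_commute)
      then show ?thesis
        using 3 unfolding edges_graph_join verts_graph_on verts_complete_graph by blast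
    next
      case 4
      then have "{a, b} \<in> edges (complete_graph C)"
        using ab unfolding complete_graph_def edges_graph_on by blast
      then have "Inr ` {a, b} \<in> edges ?H"
        unfolding edges_graph_join by blast
      then show ?thesis using e fC 4 by simp
    qed
  next
    \<comment> \<open>Every edge of the join has the form \<open>{f a, f b}\<close>, so it remains
      to pull back its endpoints and check their adjacency.\<close>
    have step: "{f a, f b} \<in> (`) f ` edges ?G"
      if "a \<in> A \<union> C" "b \<in> A \<union> C" "a \<noteq> b" "adj a b" for a b
    proof -
      have "f ` {a, b} \<in> (`) f ` edges ?G"
        using that unfolding edges_graph_on by blast
      then show ?thesis by simp
    qed
    fix e assume "e \<in> edges ?H"
    then consider
        (left) x y where "x \<in> A" "y \<in> A" "h x \<noteq> h y" "adj' (h x) (h y)" "e = {Inl (h x), Inl (h y)}"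
      | (right) x y where "x \<in> C" "y \<in> C" "x \<noteq> y" "e = {Inr x, Inr y}"
      | (cross) x y where "x \<in> A" "y \<in> C" "e = {Inl (h x), Inr y}"
      by (auto simp: graph_join_def complete_graph_def edges_graph_on)
    then show "e \<in> (`) f ` edges ?G"
    proof cases
      case left
      then show ?thesis using step[of x y] adj fA by auto
    next
      case right
      then show ?thesis using step[of x y] univ fC by auto
    next
      case cross
      then have "x \<noteq> y" using disj by blast
      then show ?thesis using step[of x y] univ fA fC cross by auto
    qed
  qed
  ultimately show ?thesis
    by (simp add: graph_eq_via_def f_def)
qed

text \<open>The third assumption is antisymmetry at \<open>z\<close> alone; it makes the least
  element unique without first establishing that \<open>P\<close> is a partial order.\<close>

lemma poset_zero_eqI:
  assumes "z \<in> carrier P" "\<And>x. x \<in> carrier P \<Longrightarrow> le P z x"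
    and "\<And>x. x \<in> carrier P \<Longrightarrow> le P x z \<Longrightarrow> x = z"
  shows "poset_zero P = z"
  unfolding poset_zero_def
  by (rule the_equality) (use assms in \<open>auto simp: least_def\<close>)

section \<open>Coordinates and supports with respect to the basis\<close>

locale indexed_basis = finite_dimensional_vector_space scale B
  for scale :: "'f::field \<Rightarrow> 'v::ab_group_add \<Rightarrow> 'v" and B :: "'v set" +
  fixes v :: "nat \<Rightarrow> 'v" and n :: nat
  assumes bij_v: "bij_betw v {1..n} B"
begin

definition support :: "'v \<Rightarrow> nat set" where
  "support a = {i \<in> {1..n}. coord scale v n a i \<noteq> 0}"

lemma image_v: "v ` {1..n} = B"
  using bij_v by (simp add: bij_betw_def)

lemma inj_v: "inj_on v {1..n}"
  using bij_v by (simp add: bij_betw_def)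

lemma coord_eq: "coord scale v n a i = representation B a (v i)"
  unfolding coord_def image_v ..

lemma exists_coord: "\<exists>a. \<forall>i \<in> {1..n}. coord scale v n a i = f i"
proof (intro exI ballI)
  \<comment> \<open>\<open>representation\<close> takes basis vectors rather than indices, so the
    prescribed coefficients are transported along the inverse of \<open>v\<close>.\<close>
  let ?g = "\<lambda>b. f (inv_into {1..n} v b)"
  let ?a = "\<Sum>b\<in>B. scale (?g b) b"
  fix i assume i: "i \<in> {1..n}"
  then have vB: "v i \<in> B" using image_v by auto
  have "representation B ?a (v i) = (\<Sum>b\<in>B. ?g b * (if b = v i then 1 else 0))"
    using independent_Basis
    by (subst representation_sum)
      (auto intro!: sum.cong simp: span_scale span_base representation_scale representation_basis)
  also have "\<dots> = ?g (v i)"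
    using vB finite_Basis by (simp add: sum.delta if_distrib cong: if_cong)
  finally show "coord scale v n ?a i = f i"
    using i inj_v by (simp add: coord_eq inv_into_f_f)
qed

text \<open>Representations vanish off \<open>B\<close>, so the coordinates determine the whole
  function \<open>representation B a\<close>, and \<open>a\<close> is recovered from it as a linear
  combination.\<close>

lemma coord_inject:
  assumes "\<And>i. i \<in> {1..n} \<Longrightarrow> coord scale v n a i = coord scale v n b i"
  shows "a = b"
proof -
  have "representation B a x = representation B b x" for x
  proof (cases "x \<in> B")
    case True
    then show ?thesis using assms image_v unfolding coord_eq by blast
  next
    case False
    then show ?thesis using representation_ne_zero by metis
  qed
  then have eq: "representation B a = representation B b" ..
  have sum_eq: "(\<Sum>x | representation B c x \<noteq> 0. scale (representation B c x) x) = c" for c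
    by (rule sum_nonzero_representation_eq) (simp_all add: independent_Basis span_Basis)
  show ?thesis
    using sum_eq[of a] sum_eq[of b] unfolding eq by (rule trans[OF sym])
qed

lemma support_subset: "support a \<subseteq> {1..n}"
  by (auto simp: support_def)

lemma support_eq_empty_iff: "support a = {} \<longleftrightarrow> a = 0"
proof
  assume "support a = {}"
  then have "coord scale v n a i = coord scale v n 0 i" if "i \<in> {1..n}" for i
    using that unfolding support_def coord_eq representation_zero by blast
  then show "a = 0" by (rule coord_inject)
next
  assume "a = 0"
  then show "support a = {}" by (simp add: support_def coord_eq representation_zero)
qed

lemma exists_support:
  assumes "I \<subseteq> {1..n}"
  obtains a where "support a = I"
proof -
  obtain a where "\<forall>i \<in> {1..n}. coord scale v n a i = (if i \<in> I then 1 else 0)"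
    using exists_coord ..
  then have "support a = I"
    using assms by (auto simp: support_def split: if_splits)
  then show ?thesis by (rule that)
qed

text \<open>\<open>vclass\<close> ignores members of \<open>I\<close> outside \<open>{1..n}\<close>,
  whereas a support never has any; hence the bound on \<open>I\<close>.\<close>

lemma vclass_iff: "I \<subseteq> {1..n} \<Longrightarrow> a \<in> vclass scale v n I \<longleftrightarrow> support a = I"
  by (auto simp: vclass_def support_def)

lemma skeleton_eq: "skeleton scale v n a = v ` support a"
  by (auto simp: skeleton_def support_def)

text \<open>Injectivity of \<open>v\<close> translates intersections of sets of basis vectors into
  intersections of index sets.\<close>

lemma skeleton_Int_iff:
  "skeleton scale v n a \<inter> skeleton scale v n b \<noteq> {} \<longleftrightarrow> support a \<inter> support b \<noteq> {}"
proof -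
  have "skeleton scale v n a \<inter> skeleton scale v n b = v ` (support a \<inter> support b)"
    unfolding skeleton_eq by (rule inj_on_image_Int[OF inj_v support_subset support_subset, symmetric])
  then show ?thesis by simp
qed

lemma skeleton_Un_iff:
  "skeleton scale v n a \<union> skeleton scale v n b = v ` {1..n} \<longleftrightarrow> support a \<union> support b = {1..n}"
  unfolding skeleton_eq image_Un[symmetric]
  by (rule inj_on_image_eq_iff[OF inj_v]) (use support_subset in auto)

text \<open>Vectors of full support correspond to families of \<open>n\<close> nonzero scalars,
  which yields the value of \<open>t\<close>. \<open>Func\<close> contains only functions that are
  \<open>undefined\<close> off their domain, hence the conditional.\<close>

lemma bij_betw_full_vclass:
  "bij_betw (\<lambda>a i. if i \<in> {1..n} then coord scale v n a i else undefined)
     (vclass scale v n {1..n}) (Func {1..n} (UNIV - {0}))" (is "bij_betw ?h _ _")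
proof (rule bij_betw_imageI)
  show "inj_on ?h (vclass scale v n {1..n})"
    by (rule inj_onI, rule coord_inject) (metis (mono_tags, lifting))
  show "?h ` vclass scale v n {1..n} = Func {1..n} (UNIV - {0})"
  proof (intro subset_antisym subsetI)
    fix g assume "g \<in> Func {1..n} (UNIV - {0 :: 'f})"
    then have g: "\<And>i. i \<in> {1..n} \<Longrightarrow> g i \<noteq> 0" "\<And>i. i \<notin> {1..n} \<Longrightarrow> g i = undefined"
      by (auto simp: Func_def)
    obtain a where a: "\<forall>i \<in> {1..n}. coord scale v n a i = g i"
      using exists_coord ..
    have "a \<in> vclass scale v n {1..n}" using a g by (simp add: vclass_def)
    moreover have "g = ?h a" using a g by auto
    ultimately show "g \<in> ?h ` vclass scale v n {1..n}" by blast
  qed (auto simp: Func_def vclass_def)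
qed

lemma full_vclass_ordIso: "|vclass scale v n {1..n}| =o |UNIV - {0::'f}| ^c |{1..n}|"
  unfolding cexp_def Field_card_of card_of_ordIso[symmetric]
  using bij_betw_full_vclass by blast

lemma card_full_vclass:
  assumes "finite (UNIV :: 'f set)"
  shows "finite (vclass scale v n {1..n})"
    and "card (vclass scale v n {1..n}) = (card (UNIV :: 'f set) - 1) ^ n"
proof -
  \<comment> \<open>Rewritten as an extensional product, the function space can be counted by the
    product formula.\<close>
  have F: "Func {1..n} (UNIV - {0::'f}) = {1..n} \<rightarrow>\<^sub>E (UNIV - {0})"
    by (auto simp: Func_def PiE_def Pi_def extensional_def)
  show "finite (vclass scale v n {1..n})"
    using bij_betw_finite[OF bij_betw_full_vclass] assms F
    by (simp add: finite_PiE finite_subset[OF subset_UNIV])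
  show "card (vclass scale v n {1..n}) = (card (UNIV :: 'f set) - 1) ^ n"
    using bij_betw_same_card[OF bij_betw_full_vclass] assms F
    by (simp add: card_PiE card_Diff_singleton)
qed

end

section \<open>The order of the lattice\<close>

locale indexed_basis_orders = indexed_basis scale B v n
  for scale :: "'f::field \<Rightarrow> 'v::ab_group_add \<Rightarrow> 'v" and B v n +
  fixes ord :: "nat set \<Rightarrow> 'v rel"
  assumes admissible: "admissible_orders scale v n ord"
begin

abbreviation L :: "'v lelem gorder" where
  "L \<equiv> lattice_of scale v n ord"

text \<open>These are the vectors that survive as elements of the lattice.\<close>

definition proper :: "'v set" where
  "proper = {a. support a \<in> proper_indices n}"

lemma proper_indices_subset: "I \<in> proper_indices n \<Longrightarrow> I \<subseteq> {1..n}"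
  by (auto simp: proper_indices_def)

lemma le_L: "le L = lle scale v n ord"
  by (simp add: lattice_of_def)

lemma carrier_L: "carrier L = {Zero, One} \<union> Vec ` proper"
proof -
  have "(\<Union>I \<in> proper_indices n. vclass scale v n I) = proper"
    using vclass_iff proper_indices_subset by (auto simp: proper_def)
  then show ?thesis by (simp add: lattice_of_def)
qed

lemma proper_ord_total:
  assumes "x \<in> proper" "y \<in> proper" "support x = support y"
  shows "(x, y) \<in> ord (support x) \<or> (y, x) \<in> ord (support x)"
proof -
  let ?I = "support x"
  have I: "?I \<in> proper_indices n" using assms by (simp add: proper_def)
  then have "well_order_on (vclass scale v n ?I) (ord ?I)"
    using admissible by (simp add: admissible_orders_def)
  \<comment> \<open>Totality compares distinct elements only; reflexivity covers
    \<open>x = y\<close>.\<close>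
  then have "total_on (vclass scale v n ?I) (ord ?I)" "refl_on (vclass scale v n ?I) (ord ?I)"
    by (auto simp: well_order_on_def linear_order_on_def partial_order_on_def preorder_on_def)
  moreover have "x \<in> vclass scale v n ?I" "y \<in> vclass scale v n ?I"
    using assms vclass_iff[OF support_subset] by auto
  ultimately show ?thesis
    by (metis refl_onD total_on_def)
qed

text \<open>A vector lies in exactly one class, so the index sets \<open>I\<close> and
  \<open>J\<close> in \<open>lle\<close> can only be the two supports.\<close>

lemma le_Vec_iff:
  assumes "x \<in> proper" "y \<in> proper"
  shows "lle scale v n ord (Vec x) (Vec y) \<longleftrightarrow>
    support x \<subset> support y \<or> support x = support y \<and> (x, y) \<in> ord (support x)"
proof -
  have "z \<in> vclass scale v n I \<longleftrightarrow> I = support z" if "I \<in> proper_indices n" for I z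
    using vclass_iff[OF proper_indices_subset[OF that]] by auto
  then show ?thesis
    using assms by (simp add: lle_def proper_def cong: bex_cong)
qed

lemma lle_simps [simp]:
  "lle scale v n ord Zero q" "lle scale v n ord p One"
  "lle scale v n ord p Zero \<longleftrightarrow> p = Zero" "lle scale v n ord One q \<longleftrightarrow> q = One"
  by (auto simp: lle_def)

lemma poset_zero_L: "poset_zero L = Zero"
  by (rule poset_zero_eqI) (auto simp: carrier_L le_L)

lemma poset_zero_inv_L: "poset_zero (inv_gorder L) = One"
  by (rule poset_zero_eqI) (auto simp: carrier_L le_L)

lemma le_Vec_linear:
  assumes "x \<in> proper" "y \<in> proper" "support x = support y"
  shows "lle scale v n ord (Vec x) (Vec y) \<or> lle scale v n ord (Vec y) (Vec x)"
  using proper_ord_total[OF assms] assms by (auto simp: le_Vec_iff)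

lemma le_Vec_refl: "x \<in> proper \<Longrightarrow> lle scale v n ord (Vec x) (Vec x)"
  using le_Vec_linear by blast

text \<open>A proper vector below both has nonempty support inside the intersection. Conversely, a
  nonempty intersection always admits such a vector, and it may be \<open>x\<close> or
  \<open>y\<close> itself.\<close>

lemma Lower_Vec_iff:
  assumes x: "x \<in> proper" and y: "y \<in> proper"
  shows "Lower L {Vec x, Vec y} = {Zero} \<longleftrightarrow> support x \<inter> support y = {}"
proof
  assume LZ: "Lower L {Vec x, Vec y} = {Zero}"
  have no: False if "z \<in> proper" "lle scale v n ord (Vec z) (Vec x)"
    "lle scale v n ord (Vec z) (Vec y)" for z
  proof -
    have "Vec z \<in> Lower L {Vec x, Vec y}"
      using that by (auto simp: Lower_def carrier_L le_L)
    then show False using LZ by simp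
  qed
  show "support x \<inter> support y = {}"
  proof (rule ccontr)
    assume ne: "support x \<inter> support y \<noteq> {}"
    obtain z where z: "support z = support x \<inter> support y"
      using exists_support[of "support x \<inter> support y"] support_subset by blast
    have zp: "z \<in> proper" using z ne x by (auto simp: proper_def proper_indices_def)
    \<comment> \<open>For comparable supports, one of \<open>x\<close> and \<open>y\<close> is a
      common lower bound, chosen by the chain order if the supports agree. Otherwise the
      intersection is strictly smaller than both supports, and \<open>z\<close> serves.\<close>
    consider "support x = support y" | "support x \<subset> support y" | "support y \<subset> support x"
      | "support z \<subset> support x" "support z \<subset> support y"
      using z by blast
    then show False
    proof cases
      case 1
      then show False
        using le_Vec_linear[OF x y] no[OF x] no[OF y] le_Vec_refl x y by blast
    qed (use no[OF x] no[OF y] no[OF zp] le_Vec_refl x y zp in \<open>auto simp: le_Vec_iff\<close>)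
  qed
next
  assume disj: "support x \<inter> support y = {}"
  have "\<not> (lle scale v n ord (Vec z) (Vec x) \<and> lle scale v n ord (Vec z) (Vec y))"
    if "z \<in> proper" for z
    using that x y disj by (auto simp: le_Vec_iff proper_def proper_indices_def)
  then show "Lower L {Vec x, Vec y} = {Zero}"
    using x y by (auto simp: Lower_def carrier_L le_L)
qed

lemma Upper_Vec_iff:
  assumes x: "x \<in> proper" and y: "y \<in> proper"
  shows "Upper L {Vec x, Vec y} = {One} \<longleftrightarrow> support x \<union> support y = {1..n}"
proof
  assume UO: "Upper L {Vec x, Vec y} = {One}"
  have no: False if "z \<in> proper" "lle scale v n ord (Vec x) (Vec z)"
    "lle scale v n ord (Vec y) (Vec z)" for z
  proof -
    have "Vec z \<in> Upper L {Vec x, Vec y}"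
      using that by (auto simp: Upper_def carrier_L le_L)
    then show False using UO by simp
  qed
  show "support x \<union> support y = {1..n}"
  proof (rule ccontr)
    assume ne: "support x \<union> support y \<noteq> {1..n}"
    obtain z where z: "support z = support x \<union> support y"
      using exists_support[of "support x \<union> support y"] support_subset by blast
    have zp: "z \<in> proper"
      using z ne x support_subset[of z] by (auto simp: proper_def proper_indices_def)
    \<comment> \<open>The dual choice: the larger of \<open>x\<close> and \<open>y\<close> if the
      supports are comparable, and otherwise \<open>z\<close>, whose support strictly contains
      both.\<close>
    consider "support x = support y" | "support x \<subset> support y" | "support y \<subset> support x"
      | "support x \<subset> support z" "support y \<subset> support z"
      using z by blast
    then show False
    proof cases
      case 1
      then show False
        using le_Vec_linear[OF x y] no[OF x] no[OF y] le_Vec_refl x y by blast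
    qed (use no[OF x] no[OF y] no[OF zp] le_Vec_refl x y zp in \<open>auto simp: le_Vec_iff\<close>)
  qed
next
  assume cover: "support x \<union> support y = {1..n}"
  have "\<not> (lle scale v n ord (Vec x) (Vec z) \<and> lle scale v n ord (Vec y) (Vec z))"
    if "z \<in> proper" for z
  proof
    assume "lle scale v n ord (Vec x) (Vec z) \<and> lle scale v n ord (Vec y) (Vec z)"
    then have "{1..n} \<subseteq> support z"
      using that x y cover by (auto simp: le_Vec_iff)
    then show False using that by (auto simp: proper_def proper_indices_def)
  qed
  then show "Upper L {Vec x, Vec y} = {One}"
    using x y by (auto simp: Upper_def carrier_L le_L)
qed

section \<open>Zero-divisors of the lattice and of its dual\<close>

lemma exists_complement:
  assumes "x \<in> proper"
  obtains y where "y \<in> proper" "support y = {1..n} - support x"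
proof -
  obtain y where y: "support y = {1..n} - support x"
    using exists_support[of "{1..n} - support x"] by blast
  moreover have "y \<in> proper"
    using y assms unfolding proper_def proper_indices_def by auto
  ultimately show ?thesis using that by blast
qed

lemma zero_divisors_L: "zero_divisors L - {Zero} = Vec ` proper"
proof (intro subset_antisym subsetI)
  fix a assume a: "a \<in> zero_divisors L - {Zero}"
  then obtain b where "b \<in> carrier L" "b \<noteq> Zero" "Lower L {a, b} = {Zero}"
    by (auto simp: zero_divisors_def poset_zero_L)
  \<comment> \<open>This excludes \<open>One\<close>: any partner \<open>b\<close> would be a
    nonzero common lower bound of \<open>One\<close> and \<open>b\<close>.\<close>
  moreover have "b \<in> Lower L {One, b}" if "b \<in> carrier L" for b
    using that le_Vec_refl by (auto simp: Lower_def carrier_L le_L)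
  ultimately have "a \<noteq> One" by auto
  then show "a \<in> Vec ` proper"
    using a by (auto simp: zero_divisors_def carrier_L)
next
  fix a assume "a \<in> Vec ` proper"
  then obtain x where x: "x \<in> proper" "a = Vec x" by blast
  obtain y where "y \<in> proper" "support y = {1..n} - support x"
    using exists_complement[OF x(1)] .
  then have "Lower L {a, Vec y} = {Zero}" "Vec y \<in> carrier L"
    using x by (auto simp: Lower_Vec_iff carrier_L)
  then show "a \<in> zero_divisors L - {Zero}"
    using x by (auto simp: zero_divisors_def poset_zero_L carrier_L)
qed

text \<open>Lower bounds in the dual are upper bounds in \<open>L\<close>, so the dual can be
  treated inside \<open>L\<close>.\<close>

lemma zero_divisors_inv_L_eq:
  "zero_divisors (inv_gorder L) = {a \<in> carrier L. \<exists>b \<in> carrier L - {One}. Upper L {a, b} = {One}}"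
  unfolding zero_divisors_def poset_zero_inv_L by simp

lemma zero_divisors_inv_L: "zero_divisors (inv_gorder L) - {One} = Vec ` proper"
proof (intro subset_antisym subsetI)
  fix a assume a: "a \<in> zero_divisors (inv_gorder L) - {One}"
  then obtain b where "b \<in> carrier L" "b \<noteq> One" "Upper L {a, b} = {One}"
    unfolding zero_divisors_inv_L_eq by blast
  moreover have "b \<in> Upper L {Zero, b}" if "b \<in> carrier L" for b
    using that le_Vec_refl by (auto simp: Upper_def carrier_L le_L)
  ultimately have "a \<noteq> Zero" by auto
  then show "a \<in> Vec ` proper"
    using a unfolding zero_divisors_inv_L_eq by (auto simp: carrier_L)
next
  fix a assume "a \<in> Vec ` proper"
  then obtain x where x: "x \<in> proper" "a = Vec x" by blast
  obtain y where y: "y \<in> proper" "support y = {1..n} - support x"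
    using exists_complement[OF x(1)] .
  \<comment> \<open>The complementary partner works here too, since a set and its complement also
    cover \<open>{1..n}\<close>.\<close>
  have "Upper L {a, Vec y} = {One}"
    unfolding x(2) Upper_Vec_iff[OF x(1) y(1)] y(2) using support_subset by blast
  moreover have "Vec y \<in> carrier L"
    using y by (simp add: carrier_L)
  ultimately show "a \<in> zero_divisors (inv_gorder L) - {One}"
    using x unfolding zero_divisors_inv_L_eq by (auto simp: carrier_L)
qed

section \<open>Identification of the component graphs with the joins\<close>

lemma graph_complement_zero_divisor_graph:
  "graph_complement (zero_divisor_graph L) =
     graph_on (Vec ` proper) (\<lambda>a b. Lower L {a, b} \<noteq> {Zero})"
  unfolding zero_divisor_graph_def poset_zero_L zero_divisors_L
  by (rule graph_complement_graph_on) (simp add: insert_commute)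

lemma zero_divisor_graph_inv_L:
  "zero_divisor_graph (inv_gorder L) =
     graph_on (Vec ` proper) (\<lambda>a b. Upper L {a, b} = {One})"
  unfolding zero_divisor_graph_def poset_zero_inv_L zero_divisors_inv_L by simp

lemma full_vclass_iff: "a \<in> vclass scale v n {1..n} \<longleftrightarrow> support a = {1..n}"
  by (rule vclass_iff) simp

text \<open>For \<open>n = 0\<close> the zero vector would have full support;
  \<open>n \<ge> 1\<close> separates the empty support from the full one.\<close>

lemma nonzero_vectors_eq:
  assumes "n \<ge> 1"
  shows "UNIV - {0} = proper \<union> vclass scale v n {1..n}"
proof -
  have "{1..n} \<noteq> {}" using assms by simp
  then have "support a \<noteq> {} \<longleftrightarrow> support a \<in> proper_indices n \<or> support a = {1..n}" for a
    using support_subset[of a] unfolding proper_indices_def by blast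
  then have "a \<in> UNIV - {0} \<longleftrightarrow> a \<in> proper \<union> vclass scale v n {1..n}" for a
    unfolding Un_iff full_vclass_iff proper_def support_eq_empty_iff by simp
  then show ?thesis by blast
qed

lemma proper_Int_full: "proper \<inter> vclass scale v n {1..n} = {}"
  unfolding disjoint_iff full_vclass_iff by (auto simp: proper_def proper_indices_def)

lemma join_copy_eq:
  "join_copy scale v n = (\<lambda>a. if a \<in> vclass scale v n {1..n} then Inr a else Inl (Vec a))"
  by (auto simp: join_copy_def)

lemma component_graph_eq:
  assumes "n \<ge> 1"
  shows "graph_eq_via (join_copy scale v n) (component_graph scale v n)
    (graph_join (graph_complement (zero_divisor_graph L))
      (complete_graph (vclass scale v n {1..n})))"
  unfolding component_graph_def graph_complement_zero_divisor_graph join_copy_eq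
    nonzero_vectors_eq[OF assms] skeleton_Int_iff
proof (rule graph_eq_via_join_complete)
  fix c x assume c: "c \<in> vclass scale v n {1..n}" and x: "x \<in> proper \<union> vclass scale v n {1..n}"
  \<comment> \<open>A full support meets the support of \<open>x\<close> as soon as the latter is
    nonempty, that is, as soon as \<open>x\<close> is nonzero.\<close>
  have "x \<noteq> 0" using nonzero_vectors_eq[OF assms] x by blast
  then have "support x \<noteq> {}" by (simp add: support_eq_empty_iff)
  then show "support c \<inter> support x \<noteq> {} \<and> support x \<inter> support c \<noteq> {}"
    using c support_subset[of x] unfolding full_vclass_iff by blast
qed (use proper_Int_full in \<open>simp_all add: Lower_Vec_iff inj_on_def\<close>)

text \<open>A full support covers \<open>{1..n}\<close> by itself, and on proper vectors
  \<open>Upper_Vec_iff\<close> matches the two adjacency relations.\<close>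

lemma component_union_graph_eq:
  assumes "n \<ge> 1"
  shows "graph_eq_via (join_copy scale v n) (component_union_graph scale v n)
    (graph_join (zero_divisor_graph (inv_gorder L))
      (complete_graph (vclass scale v n {1..n})))"
  unfolding component_union_graph_def zero_divisor_graph_inv_L join_copy_eq
    nonzero_vectors_eq[OF assms] skeleton_Un_iff
proof (rule graph_eq_via_join_complete)
  fix c x assume "c \<in> vclass scale v n {1..n}"
  then show "support c \<union> support x = {1..n} \<and> support x \<union> support c = {1..n}"
    using support_subset[of x] unfolding full_vclass_iff by blast
qed (use proper_Int_full in \<open>simp_all add: Upper_Vec_iff inj_on_def\<close>)

end

theorem theorem1p1:
  fixes scale :: "'f::field \<Rightarrow> 'v::ab_group_add \<Rightarrow> 'v"
    and v :: "nat \<Rightarrow> 'v" and B :: "'v set" and n :: nat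
    and ord :: "nat set \<Rightarrow> 'v rel"
  assumes "n \<ge> 1"
    and "finite_dimensional_vector_space scale B"
    and "bij_betw v {1..n} B"
    and "admissible_orders scale v n ord"
  shows "|vclass scale v n {1..n}| =o |UNIV - {0::'f}| ^c |{1..n}| \<and>
         (finite (UNIV :: 'f set) \<longrightarrow>
           finite (vclass scale v n {1..n}) \<and>
           card (vclass scale v n {1..n}) = (card (UNIV :: 'f set) - 1) ^ n) \<and>
         graph_eq_via (join_copy scale v n)
           (component_graph scale v n)
           (graph_join (graph_complement (zero_divisor_graph (lattice_of scale v n ord)))
                       (complete_graph (vclass scale v n {1..n}))) \<and>
         graph_eq_via (join_copy scale v n)
           (component_union_graph scale v n)
           (graph_join (zero_divisor_graph (inv_gorder (lattice_of scale v n ord)))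
                       (complete_graph (vclass scale v n {1..n})))"
proof -
  interpret finite_dimensional_vector_space scale B by fact
  interpret indexed_basis_orders scale B v n ord
    by unfold_locales fact+
  show ?thesis
    using full_vclass_ordIso card_full_vclass component_graph_eq[OF assms(1)]
      component_union_graph_eq[OF assms(1)]
    by blast
qed

end
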